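(* Let $s\in\{1,\dots,N_s\}$, and let $\mathcal{F}_s(\lambda_n,\rho_n^s)$ be the local ELBO and $\mathcal{L}_s(\lambda_n)$ the local LM-ELBO of sensor $s$ defined in the context, with $\rho_n^{s*}(\lambda_n)$ a parameter value such that $q_n(\theta_n^s;\rho_n^{s*}(\lambda_n))=q_n^*(\theta_n^s)$. At every $\lambda_n$ at which both derivatives below exist, $$\nabla_{\lambda_n}\mathcal{L}_s(\lambda_n)=\nabla_{\lambda_n}\mathcal{F}_s(\lambda_n,\rho_n^s)\big|_{\rho_n^s=\rho_n^{s*}(\lambda_n)},$$ where on the right-hand side the partial gradient with respect to $\lambda_n$ is taken with $\rho_n^s$ held fixed, and $\rho_n^s=\rho_n^{s*}(\lambda_n)$ is substituted afterwards.
   Context: Model (fixed time step $n$). There are $K$ objects with joint state $X_n=(X_{n,1},\dots,X_{n,K})$, each $X_{n,k}$ a Euclidean vector, and $N_s$ sensors. Sensor $s$ has fixed measurements $Y_n^s=(Y_{n,1}^s,\dots,Y_{n,M_n^s}^s)$ and an unknown association vector $\theta_n^s=(\theta_{n,1}^s,\dots,\theta_{n,M_n^s}^s)\in\{0,1,\dots,K\}^{M_n^s}$. Put $\theta_n=(\theta_n^1,\dots,\theta_n^{N_s})$. The likelihood is $p(Y_n^s|\theta_n^s,X_n)=\prod_{j=1}^{M_n^s}\ell^s(Y_{n,j}^s|X_{n,\theta_{n,j}^s})$, where $\ell^s(y|X_{n,k})=\mathcal{N}(y;HX_{n,k},R_k^s)$ (Gaussian density with mean $HX_{n,k}$ and positive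 definite covariance $R_k^s$) for $k\ge1$, and $\ell^s(y|X_{n,0})=1/V^s$ with $V^s>0$ for $k=0$ (clutter). The association prior is $p(\theta_n^s|M_n^s)=\prod_{j}p(\theta_{n,j}^s)$ with $p(\theta_{n,j}^s=k)=\Lambda_k^s/\sum_{l=0}^K\Lambda_l^s$, where $\Lambda_k^s>0$ are Poisson rates. $\hat p_n(X_n)$ is a fixed predictive prior probability density. Variational families: $q_n(X_n;\lambda_n)=\prod_{k=1}^Kq_n(X_{n,k};\lambda_{n,k})$ with $\lambda_n=[\lambda_{n,1},\dots,\lambda_{n,K}]$ (probability densities), and $q_n(\theta_n;\rho_n)=\prod_{s=1}^{N_s}q_n(\theta_n^s;\rho_n^s)$ with $\rho_n=[\rho_n^1,\dots,\rho_n^{N_s}]$ (probability mass functions), the parameters $\lambda_n$ and $\rho_n^s$ ranging over open subsets of Euclidean spaces. The component parameters $\rho_n^1,\dots,\rho_n^{N_s}$ range independently. Local ELBO: $$\mathcal{F}_s(\lambda_n,\rho_n^s)=\mathrm{E}_{q_n(X_n;\lambda_n)q_n(\theta_n^s;\rho_n^s)}\log p(Y_n^s|\theta_n^s,X_n)+\mathrm{E}_{q_n(\theta_n^s;\rho_n^s)}\log\frac{p(\theta_n^s|M_n^s)}{q_n(\theta_n^s;\rho_n^s)}+\frac1{N_s}\mathrm{E}_{q_n(X_n;\lambda_n)}\log\frac{\hat p_n(X_n)}{q_n(X_n;\lambda_n)}.$$ Optimal association distribution (depending on $\lambda_n$): $q_n^*(\theta_n^s)=\prod_{j=1}^{M_n^s}q_n^*(\theta_{n,j}^s)$,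 with $q_n^*(\theta_{n,j}^s)\propto p(\theta_{n,j}^s)\exp\big(\mathrm{E}_{q_n(X_n;\lambda_n)}\log\ell^s(Y_{n,j}^s|X_{n,\theta_{n,j}^s})\big)$. Local LM-ELBO: $$\mathcal{L}_s(\lambda_n)=\mathrm{E}_{q_n(X_n;\lambda_n)q_n^*(\theta_n^s)}\log p(Y_n^s|\theta_n^s,X_n)+\mathrm{E}_{q_n^*(\theta_n^s)}\log\frac{p(\theta_n^s|M_n^s)}{q_n^*(\theta_n^s)}+\frac1{N_s}\mathrm{E}_{q_n(X_n;\lambda_n)}\log\frac{\hat p_n(X_n)}{q_n(X_n;\lambda_n)}.$$ Standing assumptions: for every $\lambda_n$, $q_n^*(\theta_n^s)$ belongs to the family $\{q_n(\theta_n^s;\rho_n^s)\}$, and $\rho_n^{s*}(\lambda_n)$ denotes a parameter value with $q_n(\theta_n^s;\rho_n^{s*}(\lambda_n))=q_n^*(\theta_n^s)$. All the expectations are finite. The convention $0\log 0=0$ is used. *)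

theory Defs
  imports "HOL-Analysis.Analysis"
begin

text \<open>
  Expectation under the law with density \<open>p\<close> relative to a reference measure \<open>M\<close>: a product of
  Lebesgue measures for states, a counting measure on a finite set for associations.
  Since \<open>p\<close> multiplies the integrand and \<open>ln 0 = 0\<close> in HOL, points with \<open>p = 0\<close> contribute \<open>0\<close>, as
  required by the convention \<open>0 log 0 = 0\<close>.
\<close>

definition is_density :: "'a measure \<Rightarrow> ('a \<Rightarrow> real) \<Rightarrow> bool" where
  "is_density M p \<longleftrightarrow>
     p \<in> borel_measurable M \<and> (\<forall>x\<in>space M. 0 \<le> p x) \<and> has_bochner_integral M p 1"

definition expect :: "'a measure \<Rightarrow> ('a \<Rightarrow> real) \<Rightarrow> ('a \<Rightarrow> real) \<Rightarrow> real" where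
  "expect M p f = (\<integral>x. p x * f x \<partial>M)"

definition expect_finite :: "'a measure \<Rightarrow> ('a \<Rightarrow> real) \<Rightarrow> ('a \<Rightarrow> real) \<Rightarrow> bool" where
  "expect_finite M p f \<longleftrightarrow> integrable M (\<lambda>x. p x * f x)"

definition pos_def_matrix :: "real^'m^'m \<Rightarrow> bool" where
  "pos_def_matrix A \<longleftrightarrow> transpose A = A \<and> (\<forall>v. v \<noteq> 0 \<longrightarrow> 0 < v \<bullet> (A *v v))"

definition gauss_density :: "real^'m \<Rightarrow> real^'m^'m \<Rightarrow> real^'m \<Rightarrow> real" where
  "gauss_density \<mu> \<Sigma> y =
     exp (- ((y - \<mu>) \<bullet> (matrix_inv \<Sigma> *v (y - \<mu>))) / 2) / sqrt ((2 * pi) ^ CARD('m) * det \<Sigma>)"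

text \<open>
  Objects are \<open>1..n_obj\<close>, sensors \<open>1..n_sens\<close>, the measurements of sensor \<open>s\<close> are \<open>1..n_meas s\<close>, and
  association value \<open>0\<close> means clutter.

  The state parameter \<open>[\<lambda>\<^sub>1, \<dots>, \<lambda>\<^sub>K]\<close> is a single vector of type \<open>real^'l\<close>; coordinate \<open>i\<close> belongs to
  the component \<open>\<lambda>\<^sub>k\<close> with \<open>k = lam_obj i\<close>, so that components may have different dimensions.
  The association parameter of sensor \<open>s\<close> lies in Euclidean space of dimension \<open>rho_dim s\<close>, in the
  library's sequence representation.
\<close>

record ('l, 'd, 'm) tracking_model =
  n_obj :: nat
  n_sens :: nat
  n_meas :: "nat \<Rightarrow> nat"
  meas :: "nat \<Rightarrow> nat \<Rightarrow> real^'m"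
  obs_mat :: "real^'d^'m"
  obs_cov :: "nat \<Rightarrow> nat \<Rightarrow> real^'m^'m"
  clutter_vol :: "nat \<Rightarrow> real"
  rate :: "nat \<Rightarrow> nat \<Rightarrow> real"
  pred_prior :: "(nat \<Rightarrow> real^'d) \<Rightarrow> real"
  lam_dom :: "(real^'l) set"
  lam_obj :: "'l \<Rightarrow> nat"
  q_obj :: "nat \<Rightarrow> ('l \<Rightarrow> real) \<Rightarrow> real^'d \<Rightarrow> real"
  rho_dim :: "nat \<Rightarrow> nat"
  rho_dom :: "nat \<Rightarrow> (nat \<Rightarrow> real) set"
  q_assoc :: "nat \<Rightarrow> (nat \<Rightarrow> real) \<Rightarrow> (nat \<Rightarrow> nat) \<Rightarrow> real"

type_synonym 'd joint_state = "nat \<Rightarrow> real^'d"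
type_synonym assoc_vec = "nat \<Rightarrow> nat"

definition state_meas ::
    "('l::finite, 'd::finite, 'm::finite) tracking_model \<Rightarrow> 'd joint_state measure" where
  "state_meas D = (\<Pi>\<^sub>M k\<in>{1..n_obj D}. lborel)"

definition assoc_set ::
    "('l::finite, 'd::finite, 'm::finite) tracking_model \<Rightarrow> nat \<Rightarrow> assoc_vec set" where
  "assoc_set D s = (\<Pi>\<^sub>E j\<in>{1..n_meas D s}. {0..n_obj D})"

definition lik ::
    "('l::finite, 'd::finite, 'm::finite) tracking_model \<Rightarrow> nat \<Rightarrow> real^'m \<Rightarrow> 'd joint_state \<Rightarrow> nat \<Rightarrow> real" where
  "lik D s y X k =
     (if k = 0 then 1 / clutter_vol D s else gauss_density (obs_mat D *v X k) (obs_cov D s k) y)"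

definition meas_lik ::
    "('l::finite, 'd::finite, 'm::finite) tracking_model \<Rightarrow> nat \<Rightarrow> assoc_vec \<Rightarrow> 'd joint_state \<Rightarrow> real" where
  "meas_lik D s \<theta> X = (\<Prod>j\<in>{1..n_meas D s}. lik D s (meas D s j) X (\<theta> j))"

definition assoc_prior1 ::
    "('l::finite, 'd::finite, 'm::finite) tracking_model \<Rightarrow> nat \<Rightarrow> nat \<Rightarrow> real" where
  "assoc_prior1 D s k = rate D s k / (\<Sum>l\<in>{0..n_obj D}. rate D s l)"

definition assoc_prior ::
    "('l::finite, 'd::finite, 'm::finite) tracking_model \<Rightarrow> nat \<Rightarrow> assoc_vec \<Rightarrow> real" where
  "assoc_prior D s \<theta> = (\<Prod>j\<in>{1..n_meas D s}. assoc_prior1 D s (\<theta> j))"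

definition lam_comp ::
    "('l::finite, 'd::finite, 'm::finite) tracking_model \<Rightarrow> real^'l \<Rightarrow> nat \<Rightarrow> 'l \<Rightarrow> real" where
  "lam_comp D lam k = restrict (\<lambda>i. lam $ i) {i. lam_obj D i = k}"

definition q_state ::
    "('l::finite, 'd::finite, 'm::finite) tracking_model \<Rightarrow> real^'l \<Rightarrow> 'd joint_state \<Rightarrow> real" where
  "q_state D lam X = (\<Prod>k\<in>{1..n_obj D}. q_obj D k (lam_comp D lam k) (X k))"

definition local_elbo ::
    "('l::finite, 'd::finite, 'm::finite) tracking_model \<Rightarrow> nat \<Rightarrow> real^'l \<Rightarrow> (nat \<Rightarrow> real) \<Rightarrow> real" where
  "local_elbo D s lam \<rho> =
     expect (state_meas D \<Otimes>\<^sub>M count_space (assoc_set D s))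
       (\<lambda>(X, \<theta>). q_state D lam X * q_assoc D s \<rho> \<theta>) (\<lambda>(X, \<theta>). ln (meas_lik D s \<theta> X))
   + expect (count_space (assoc_set D s)) (q_assoc D s \<rho>)
       (\<lambda>\<theta>. ln (assoc_prior D s \<theta> / q_assoc D s \<rho> \<theta>))
   + 1 / real (n_sens D) *
     expect (state_meas D) (q_state D lam) (\<lambda>X. ln (pred_prior D X / q_state D lam X))"

definition opt_weight ::
    "('l::finite, 'd::finite, 'm::finite) tracking_model \<Rightarrow> nat \<Rightarrow> real^'l \<Rightarrow> nat \<Rightarrow> nat \<Rightarrow> real" where
  "opt_weight D s lam j k =
     assoc_prior1 D s k *
     exp (expect (state_meas D) (q_state D lam) (\<lambda>X. ln (lik D s (meas D s j) X k)))"

definition opt_assoc1 ::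
    "('l::finite, 'd::finite, 'm::finite) tracking_model \<Rightarrow> nat \<Rightarrow> real^'l \<Rightarrow> nat \<Rightarrow> nat \<Rightarrow> real" where
  "opt_assoc1 D s lam j k = opt_weight D s lam j k / (\<Sum>l\<in>{0..n_obj D}. opt_weight D s lam j l)"

definition opt_assoc ::
    "('l::finite, 'd::finite, 'm::finite) tracking_model \<Rightarrow> nat \<Rightarrow> real^'l \<Rightarrow> assoc_vec \<Rightarrow> real" where
  "opt_assoc D s lam \<theta> = (\<Prod>j\<in>{1..n_meas D s}. opt_assoc1 D s lam j (\<theta> j))"

definition local_lm_elbo ::
    "('l::finite, 'd::finite, 'm::finite) tracking_model \<Rightarrow> nat \<Rightarrow> real^'l \<Rightarrow> real" where
  "local_lm_elbo D s lam =
     expect (state_meas D \<Otimes>\<^sub>M count_space (assoc_set D s))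
       (\<lambda>(X, \<theta>). q_state D lam X * opt_assoc D s lam \<theta>) (\<lambda>(X, \<theta>). ln (meas_lik D s \<theta> X))
   + expect (count_space (assoc_set D s)) (opt_assoc D s lam)
       (\<lambda>\<theta>. ln (assoc_prior D s \<theta> / opt_assoc D s lam \<theta>))
   + 1 / real (n_sens D) *
     expect (state_meas D) (q_state D lam) (\<lambda>X. ln (pred_prior D X / q_state D lam X))"

definition observation_model ::
    "('l::finite, 'd::finite, 'm::finite) tracking_model \<Rightarrow> bool" where
  "observation_model D \<longleftrightarrow>
     (\<forall>s\<in>{1..n_sens D}.
        0 < clutter_vol D s \<and>
        (\<forall>k\<in>{1..n_obj D}. pos_def_matrix (obs_cov D s k)) \<and>
        (\<forall>k\<in>{0..n_obj D}. 0 < rate D s k)) \<and>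
     is_density (state_meas D) (pred_prior D)"

definition variational_families ::
    "('l::finite, 'd::finite, 'm::finite) tracking_model \<Rightarrow> bool" where
  "variational_families D \<longleftrightarrow>
     open (lam_dom D) \<and> (\<forall>i. lam_obj D i \<in> {1..n_obj D}) \<and>
     (\<forall>lam\<in>lam_dom D. \<forall>k\<in>{1..n_obj D}. is_density lborel (q_obj D k (lam_comp D lam k))) \<and>
     (\<forall>s\<in>{1..n_sens D}.
        openin (Euclidean_space (rho_dim D s)) (rho_dom D s) \<and>
        (\<forall>\<rho>\<in>rho_dom D s. is_density (count_space (assoc_set D s)) (q_assoc D s \<rho>)))"

text \<open>
  The almost-everywhere condition is part of finiteness of \<open>E log (p / q)\<close>: where \<open>p = 0 < q\<close> the
  logarithm is \<open>-\<infinity>\<close>, but HOL's total \<open>ln\<close> returns \<open>0\<close> there.  The other logarithms have positive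
  arguments wherever the density multiplying them is positive, and expectations over associations
  alone are finite sums.
\<close>

definition finite_expectations ::
    "('l::finite, 'd::finite, 'm::finite) tracking_model \<Rightarrow> bool" where
  "finite_expectations D \<longleftrightarrow>
     (\<forall>lam\<in>lam_dom D.
        (AE X in state_meas D. 0 < q_state D lam X \<longrightarrow> 0 < pred_prior D X) \<and>
        expect_finite (state_meas D) (q_state D lam) (\<lambda>X. ln (pred_prior D X / q_state D lam X)) \<and>
        (\<forall>s\<in>{1..n_sens D}.
           (\<forall>j\<in>{1..n_meas D s}. \<forall>k\<in>{0..n_obj D}.
              expect_finite (state_meas D) (q_state D lam) (\<lambda>X. ln (lik D s (meas D s j) X k))) \<and>
           (\<forall>\<rho>\<in>rho_dom D s.
              expect_finite (state_meas D \<Otimes>\<^sub>M count_space (assoc_set D s))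
                (\<lambda>(X, \<theta>). q_state D lam X * q_assoc D s \<rho> \<theta>)
                (\<lambda>(X, \<theta>). ln (meas_lik D s \<theta> X)))))"

definition optimal_param ::
    "('l::finite, 'd::finite, 'm::finite) tracking_model \<Rightarrow> nat \<Rightarrow> (real^'l \<Rightarrow> nat \<Rightarrow> real) \<Rightarrow> bool" where
  "optimal_param D s \<rho>' \<longleftrightarrow>
     (\<forall>lam\<in>lam_dom D. \<rho>' lam \<in> rho_dom D s \<and>
        (\<forall>\<theta>\<in>assoc_set D s. q_assoc D s (\<rho>' lam) \<theta> = opt_assoc D s lam \<theta>))"

end

(*
  For each l, the optimal association law maximises rho \<mapsto> local_elbo D s l rho (Gibbs' inequality),
  and its maximum is local_lm_elbo D s l.  Hence, with rho = rho_star lam held fixed, the function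
  l \<mapsto> local_lm_elbo D s l - local_elbo D s l rho is nonnegative on the open set lam_dom D and
  vanishes at lam; at this minimum its gradient is zero.
*)
theory Submission
  imports Defs
begin

lemma pos_def_matrix_det_nonzero:
  assumes "pos_def_matrix A"
  shows "det A \<noteq> 0"
proof -
  have "v = 0" if "A *v v = 0" for v
    using assms that unfolding pos_def_matrix_def by (metis inner_zero_right less_irrefl)
  then show ?thesis
    using matrix_left_invertible_ker invertible_left_inverse invertible_det_nz by blast
qed

text \<open>The exponential never vanishes, and HOL's \<open>sqrt\<close> is zero only at zero, so a
  nonzero determinant keeps the denominator nonzero.\<close>

lemma gauss_density_nonzero:
  assumes "pos_def_matrix \<Sigma>"
  shows "gauss_density \<mu> \<Sigma> y \<noteq> 0"
  using pos_def_matrix_det_nonzero[OF assms] by (simp add: gauss_density_def)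

text \<open>Nonvanishing suffices, without positivity: HOL's \<open>ln\<close> satisfies \<open>ln (- x) = ln x\<close> and is additive on
  products of nonzero reals.\<close>

lemma lik_nonzero:
  assumes "observation_model D" "s \<in> {1..n_sens D}" "k \<le> n_obj D"
  shows "lik D s y X k \<noteq> 0"
proof (cases "k = 0")
  case True
  have "0 < clutter_vol D s"
    using assms(1,2) unfolding observation_model_def by blast
  with True show ?thesis by (simp add: lik_def)
next
  case False
  with assms have "pos_def_matrix (obs_cov D s k)"
    unfolding observation_model_def by auto
  with False gauss_density_nonzero show ?thesis
    by (simp add: lik_def)
qed

text \<open>Splits the joint log-likelihood into the one-measurement terms whose expectations enter
  \<open>opt_weight\<close>.\<close>

lemma ln_meas_lik:
  assumes "observation_model D" "s \<in> {1..n_sens D}" "\<theta> \<in> assoc_set D s"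
  shows "ln (meas_lik D s \<theta> X) = (\<Sum>j\<in>{1..n_meas D s}. ln (lik D s (meas D s j) X (\<theta> j)))"
proof -
  have "\<theta> j \<le> n_obj D" if "j \<in> {1..n_meas D s}" for j
    using assms(3) that by (auto simp: assoc_set_def dest: PiE_mem)
  with lik_nonzero[OF assms(1,2)] show ?thesis
    unfolding meas_lik_def by (intro ln_prod) auto
qed

text \<open>Applying \<open>ln t \<le> t - 1\<close> at \<open>t = p x / q x\<close> bounds each
  term by \<open>p x - q x\<close>, and these differences sum to \<open>1 - 1 = 0\<close>.\<close>

lemma gibbs_inequality:
  fixes p q :: "'a \<Rightarrow> real"
  assumes "finite A" and q: "\<And>x. x \<in> A \<Longrightarrow> 0 \<le> q x" "sum q A = 1"
    and p: "\<And>x. x \<in> A \<Longrightarrow> 0 < p x" "sum p A = 1"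
  shows "(\<Sum>x\<in>A. q x * ln (p x / q x)) \<le> 0"
proof -
  have "q x * ln (p x / q x) \<le> p x - q x" if x: "x \<in> A" for x
  proof (cases "q x = 0")
    \<comment> \<open>Here the left side is \<open>0\<close> by the convention
      \<open>0 log 0 = 0\<close>, and the bound reads \<open>0 \<le> p x\<close>.\<close>
    case True
    with p(1)[OF x] show ?thesis by simp
  next
    case False
    with q(1)[OF x] have "0 < q x" by simp
    with p(1)[OF x] have "q x * ln (p x / q x) \<le> q x * (p x / q x - 1)"
      by (intro mult_left_mono ln_le_minus_one) auto
    with \<open>0 < q x\<close> show ?thesis by (simp add: right_diff_distrib)
  qed
  then have "(\<Sum>x\<in>A. q x * ln (p x / q x)) \<le> (\<Sum>x\<in>A. p x - q x)"
    by (rule sum_mono)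
  with q(2) p(2) show ?thesis by (simp add: sum_subtractf)
qed

lemma finite_assoc_set: "finite (assoc_set D s)"
  unfolding assoc_set_def by (intro finite_PiE) auto

text \<open>Required for Fubini on the product of states and associations.\<close>

lemma sigma_finite_state_meas: "sigma_finite_measure (state_meas D)"
proof -
  interpret product_sigma_finite "\<lambda>_::nat. lborel :: (real^'d::finite) measure" ..
  show ?thesis
    unfolding state_meas_def by (rule sigma_finite) simp
qed

lemma is_density_assoc_setD:
  assumes "is_density (count_space (assoc_set D s)) q"
  shows "sum q (assoc_set D s) = 1" "\<And>\<theta>. \<theta> \<in> assoc_set D s \<Longrightarrow> 0 \<le> q \<theta>"
  using assms has_bochner_integral_integral_eq[of "count_space (assoc_set D s)" q 1]
  by (auto simp: is_density_def lebesgue_integral_count_space_finite finite_assoc_set)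

text \<open>Fubini with the state integral inside: for fixed \<theta> the weight
  \<open>r \<theta>\<close> is a constant factor and the log-likelihood is a finite sum over
  measurements; the outer integral is a finite sum as well.\<close>

lemma expect_ln_meas_lik:
  assumes obs: "observation_model D" and s: "s \<in> {1..n_sens D}"
    and fin: "\<And>j k. j \<in> {1..n_meas D s} \<Longrightarrow> k \<in> {0..n_obj D} \<Longrightarrow>
      expect_finite (state_meas D) q (\<lambda>X. ln (lik D s (meas D s j) X k))"
    and int: "expect_finite (state_meas D \<Otimes>\<^sub>M count_space (assoc_set D s))
      (\<lambda>(X, \<theta>). q X * r \<theta>) (\<lambda>(X, \<theta>). ln (meas_lik D s \<theta> X))"
  shows "expect (state_meas D \<Otimes>\<^sub>M count_space (assoc_set D s))
      (\<lambda>(X, \<theta>). q X * r \<theta>) (\<lambda>(X, \<theta>). ln (meas_lik D s \<theta> X)) =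
    (\<Sum>\<theta>\<in>assoc_set D s. r \<theta> *
      (\<Sum>j\<in>{1..n_meas D s}. expect (state_meas D) q (\<lambda>X. ln (lik D s (meas D s j) X (\<theta> j)))))"
proof -
  interpret S: sigma_finite_measure "state_meas D" by (rule sigma_finite_state_meas)
  interpret A: finite_measure "count_space (assoc_set D s)"
    by (rule finite_measure_count_space) (rule finite_assoc_set)
  interpret pair_sigma_finite "state_meas D" "count_space (assoc_set D s)" ..
  have "(\<integral>X. q X * r \<theta> * ln (meas_lik D s \<theta> X) \<partial>state_meas D) = r \<theta> *
      (\<Sum>j\<in>{1..n_meas D s}. expect (state_meas D) q (\<lambda>X. ln (lik D s (meas D s j) X (\<theta> j))))"
    if \<theta>: "\<theta> \<in> assoc_set D s" for \<theta>
  proof -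
    \<comment> \<open>Termwise integrability is what allows the sum over \<open>j\<close> to leave
      the integral.\<close>
    have "integrable (state_meas D) (\<lambda>X. q X * ln (lik D s (meas D s j) X (\<theta> j)))"
      if "j \<in> {1..n_meas D s}" for j
      using fin[OF that, of "\<theta> j"] \<theta> that unfolding assoc_set_def expect_finite_def
      by (auto dest: PiE_mem)
    then have "(\<Sum>j\<in>{1..n_meas D s}. expect (state_meas D) q (\<lambda>X. ln (lik D s (meas D s j) X (\<theta> j)))) =
        (\<integral>X. q X * ln (meas_lik D s \<theta> X) \<partial>state_meas D)"
      by (simp add: expect_def ln_meas_lik[OF obs s \<theta>] sum_distrib_left Bochner_Integration.integral_sum)
    then show ?thesis
      using integral_mult_right_zero[of "state_meas D" "r \<theta>" "\<lambda>X. q X * ln (meas_lik D s \<theta> X)"]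
      by (simp only: ac_simps)
  qed
  moreover have "(\<integral>\<theta>. (\<integral>X. q X * r \<theta> * ln (meas_lik D s \<theta> X) \<partial>state_meas D)
        \<partial>count_space (assoc_set D s)) =
      expect (state_meas D \<Otimes>\<^sub>M count_space (assoc_set D s))
        (\<lambda>(X, \<theta>). q X * r \<theta>) (\<lambda>(X, \<theta>). ln (meas_lik D s \<theta> X))"
    using int unfolding expect_def expect_finite_def
    by (subst integral_snd) (simp_all add: case_prod_unfold)
  ultimately show ?thesis
    by (simp add: lebesgue_integral_count_space_finite finite_assoc_set)
qed

text \<open>Both sides are the same expression in the association law, and all measures involved see
  that law only on \<open>assoc_set D s\<close>.\<close>

lemma local_lm_elbo_eq_local_elbo:
  assumes "\<And>\<theta>. \<theta> \<in> assoc_set D s \<Longrightarrow> q_assoc D s \<rho> \<theta> = opt_assoc D s lam \<theta>"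
  shows "local_lm_elbo D s lam = local_elbo D s lam \<rho>"
proof -
  have "expect (state_meas D \<Otimes>\<^sub>M count_space (assoc_set D s))
       (\<lambda>(X, \<theta>). q_state D lam X * opt_assoc D s lam \<theta>) f =
     expect (state_meas D \<Otimes>\<^sub>M count_space (assoc_set D s))
       (\<lambda>(X, \<theta>). q_state D lam X * q_assoc D s \<rho> \<theta>) f" for f
    unfolding expect_def using assms
    by (intro Bochner_Integration.integral_cong) (auto simp: space_pair_measure)
  moreover have "expect (count_space (assoc_set D s)) (opt_assoc D s lam)
       (\<lambda>\<theta>. ln (assoc_prior D s \<theta> / opt_assoc D s lam \<theta>)) =
     expect (count_space (assoc_set D s)) (q_assoc D s \<rho>)
       (\<lambda>\<theta>. ln (assoc_prior D s \<theta> / q_assoc D s \<rho> \<theta>))"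
    unfolding expect_def using assms by (intro Bochner_Integration.integral_cong) auto
  ultimately show ?thesis
    by (simp add: local_lm_elbo_def local_elbo_def)
qed

text \<open>Isolates the dependence on \<rho>: a finite free-energy sum plus a prior term that is
  common to all \<rho> and cancels in comparisons.\<close>

lemma local_elbo_as_sum:
  assumes obs: "observation_model D" and fin: "finite_expectations D"
    and s: "s \<in> {1..n_sens D}" and lam: "lam \<in> lam_dom D" and \<rho>: "\<rho> \<in> rho_dom D s"
  shows "local_elbo D s lam \<rho> =
    (\<Sum>\<theta>\<in>assoc_set D s. q_assoc D s \<rho> \<theta> *
      ((\<Sum>j\<in>{1..n_meas D s}.
          expect (state_meas D) (q_state D lam) (\<lambda>X. ln (lik D s (meas D s j) X (\<theta> j)))) +
       ln (assoc_prior D s \<theta> / q_assoc D s \<rho> \<theta>))) +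
    1 / real (n_sens D) *
      expect (state_meas D) (q_state D lam) (\<lambda>X. ln (pred_prior D X / q_state D lam X))"
proof -
  have "expect (state_meas D \<Otimes>\<^sub>M count_space (assoc_set D s))
      (\<lambda>(X, \<theta>). q_state D lam X * q_assoc D s \<rho> \<theta>) (\<lambda>(X, \<theta>). ln (meas_lik D s \<theta> X)) =
    (\<Sum>\<theta>\<in>assoc_set D s. q_assoc D s \<rho> \<theta> * (\<Sum>j\<in>{1..n_meas D s}.
      expect (state_meas D) (q_state D lam) (\<lambda>X. ln (lik D s (meas D s j) X (\<theta> j)))))"
    using fin s lam \<rho> unfolding finite_expectations_def
    by (intro expect_ln_meas_lik[OF obs s]) blast+
  then show ?thesis
    by (simp add: local_elbo_def expect_def[of "count_space _"]
        lebesgue_integral_count_space_finite finite_assoc_set distrib_left sum.distrib)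
qed

text \<open>The exponential turns the sum over measurements into a product of weights
  \<open>opt_weight\<close>. The constant \<open>Z\<close>, the same for every \<theta>, is the
  product of their normalisers.\<close>

lemma opt_assoc_gibbs_form:
  assumes obs: "observation_model D" and s: "s \<in> {1..n_sens D}"
  obtains Z where "0 < Z"
    and "\<And>\<theta>. \<theta> \<in> assoc_set D s \<Longrightarrow> 0 < assoc_prior D s \<theta>"
    and "\<And>\<theta>. \<theta> \<in> assoc_set D s \<Longrightarrow> assoc_prior D s \<theta> * exp (\<Sum>j\<in>{1..n_meas D s}.
        expect (state_meas D) (q_state D lam) (\<lambda>X. ln (lik D s (meas D s j) X (\<theta> j)))) =
      Z * opt_assoc D s lam \<theta>"
proof
  let ?N = "\<lambda>j. \<Sum>l\<in>{0..n_obj D}. opt_weight D s lam j l"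
  have rate: "0 < rate D s k" if "k \<in> {0..n_obj D}" for k
    using obs s that unfolding observation_model_def by blast
  then have prior1: "0 < assoc_prior1 D s k" if "k \<in> {0..n_obj D}" for k
    unfolding assoc_prior1_def using that by (intro divide_pos_pos sum_pos) auto
  then have N: "0 < ?N j" for j
    unfolding opt_weight_def by (intro sum_pos) auto
  then show "0 < (\<Prod>j\<in>{1..n_meas D s}. ?N j)"
    by (intro prod_pos) auto
  fix \<theta> assume "\<theta> \<in> assoc_set D s"
  then have "\<theta> j \<in> {0..n_obj D}" if "j \<in> {1..n_meas D s}" for j
    using that unfolding assoc_set_def by (auto dest: PiE_mem)
  with prior1 show "0 < assoc_prior D s \<theta>"
    unfolding assoc_prior_def by (intro prod_pos) auto
  have "?N j \<noteq> 0" for j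
    using N[of j] by simp
  then show "assoc_prior D s \<theta> * exp (\<Sum>j\<in>{1..n_meas D s}.
        expect (state_meas D) (q_state D lam) (\<lambda>X. ln (lik D s (meas D s j) X (\<theta> j)))) =
      (\<Prod>j\<in>{1..n_meas D s}. ?N j) * opt_assoc D s lam \<theta>"
    \<comment> \<open>The normalisers cancel inside the merged product first;
      \<open>opt_weight\<close> is unfolded only afterwards.\<close>
    by (simp add: opt_assoc_def opt_assoc1_def assoc_prior_def exp_sum
        flip: prod.distrib) (simp add: opt_weight_def)
qed

text \<open>For an association law \<open>u\<close>, the free energy equals \<open>ln Z\<close>
  minus the Kullback-Leibler divergence of \<open>u\<close> from the optimal law \<open>r\<close>.
  By Gibbs' inequality it is at most \<open>ln Z\<close>, the value at \<open>u = r\<close>.\<close>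

lemma local_elbo_le_local_lm_elbo:
  assumes obs: "observation_model D" and var: "variational_families D"
    and fin: "finite_expectations D" and s: "s \<in> {1..n_sens D}"
    and opt: "optimal_param D s rho_star" and lam: "lam \<in> lam_dom D" and \<rho>: "\<rho> \<in> rho_dom D s"
  shows "local_elbo D s lam \<rho> \<le> local_lm_elbo D s lam"
proof -
  define g where "g \<theta> = (\<Sum>j\<in>{1..n_meas D s}.
    expect (state_meas D) (q_state D lam) (\<lambda>X. ln (lik D s (meas D s j) X (\<theta> j))))" for \<theta>
  let ?A = "assoc_set D s" and ?p = "assoc_prior D s"
  define q where "q = q_assoc D s \<rho>"
  define r where "r = q_assoc D s (rho_star lam)"
  have star: "rho_star lam \<in> rho_dom D s"
    and r_opt: "\<And>\<theta>. \<theta> \<in> ?A \<Longrightarrow> r \<theta> = opt_assoc D s lam \<theta>"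
    using opt lam unfolding optimal_param_def r_def by blast+
  \<comment> \<open>Since \<open>rho_star lam\<close> is an admissible parameter, normalisation of
    \<open>r\<close> comes from the variational family.\<close>
  have "is_density (count_space ?A) q" "is_density (count_space ?A) r"
    using var s \<rho> star unfolding variational_families_def q_def r_def by blast+
  note q = is_density_assoc_setD[OF this(1)] and r = is_density_assoc_setD[OF this(2)]
  obtain Z where Z: "0 < Z" and p: "\<And>\<theta>. \<theta> \<in> ?A \<Longrightarrow> 0 < ?p \<theta>"
    and "\<And>\<theta>. \<theta> \<in> ?A \<Longrightarrow> ?p \<theta> * exp (g \<theta>) = Z * opt_assoc D s lam \<theta>"
    unfolding g_def using opt_assoc_gibbs_form[OF obs s, of lam] by blast
  with r_opt have Zr: "?p \<theta> * exp (g \<theta>) = Z * r \<theta>" if "\<theta> \<in> ?A" for \<theta>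
    using that by simp
  have r_pos: "0 < r \<theta>" if "\<theta> \<in> ?A" for \<theta>
  proof (rule zero_less_mult_pos[OF _ Z])
    show "0 < Z * r \<theta>"
      using p[OF that] by (simp flip: Zr[OF that])
  qed
  have term_eq: "u * (g \<theta> + ln (?p \<theta> / u)) = u * ln Z + u * ln (r \<theta> / u)"
    if \<theta>: "\<theta> \<in> ?A" for u \<theta>
  \<comment> \<open>At \<open>u = 0\<close> both sides vanish; otherwise the logarithm of
    \<open>Zr\<close> trades \<open>g \<theta> + ln (?p \<theta>)\<close> for
    \<open>ln Z + ln (r \<theta>)\<close>.\<close>
  proof (cases "u = 0")
    case False
    have "g \<theta> = ln Z + ln (r \<theta>) - ln (?p \<theta>)"
      using arg_cong[OF Zr[OF \<theta>], of ln] p[OF \<theta>] r_pos[OF \<theta>] Z by (simp add: ln_mult)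
    with False p[OF \<theta>] r_pos[OF \<theta>] show ?thesis
      by (simp add: ln_div distrib_left right_diff_distrib)
  qed simp
  have free_energy: "(\<Sum>\<theta>\<in>?A. u \<theta> * (g \<theta> + ln (?p \<theta> / u \<theta>))) =
      ln Z + (\<Sum>\<theta>\<in>?A. u \<theta> * ln (r \<theta> / u \<theta>))" if "sum u ?A = 1" for u
  proof -
    have "(\<Sum>\<theta>\<in>?A. u \<theta> * (g \<theta> + ln (?p \<theta> / u \<theta>))) =
        (\<Sum>\<theta>\<in>?A. u \<theta> * ln Z + u \<theta> * ln (r \<theta> / u \<theta>))"
      by (rule sum.cong[OF refl term_eq])
    then show ?thesis
      using that by (simp add: sum.distrib flip: sum_distrib_right)
  qed
  have "(\<Sum>\<theta>\<in>?A. q \<theta> * (g \<theta> + ln (?p \<theta> / q \<theta>))) \<le> ln Z"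
    using free_energy[OF q(1)] gibbs_inequality[OF finite_assoc_set q(2,1) r_pos r(1)] by simp
  \<comment> \<open>At \<open>u = r\<close> every log ratio is zero, so the bound is
    attained.\<close>
  also have "\<dots> = (\<Sum>\<theta>\<in>?A. r \<theta> * (g \<theta> + ln (?p \<theta> / r \<theta>)))"
    using free_energy[OF r(1)] by (simp add: sum.neutral)
  finally have "local_elbo D s lam \<rho> \<le> local_elbo D s lam (rho_star lam)"
    using local_elbo_as_sum[OF obs fin s lam \<rho>] local_elbo_as_sum[OF obs fin s lam star]
    by (simp add: q_def r_def g_def)
  also have "\<dots> = local_lm_elbo D s lam"
    by (rule local_lm_elbo_eq_local_elbo[symmetric]) (use r_opt in \<open>simp add: r_def\<close>)
  finally show ?thesis .
qed

text \<open>The difference \<open>f - g\<close> has a minimum at the interior point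
  \<open>x\<close>, so its gradient \<open>a - b\<close> vanishes there.\<close>

lemma GDERIV_eq_at_touching_point:
  fixes f g :: "'a::real_inner \<Rightarrow> real"
  assumes "open S" "x \<in> S" and le: "\<And>y. y \<in> S \<Longrightarrow> g y \<le> f y" and eq: "f x = g x"
    and f: "GDERIV f x :> a" and g: "GDERIV g x :> b"
  shows "a = b"
proof -
  have "((\<lambda>y. f y - g y) has_derivative (\<lambda>h. h \<bullet> (a - b))) (at x)"
    using GDERIV_diff[OF f g] by (simp add: gderiv_def)
  then have "(\<lambda>h. h \<bullet> (a - b)) = (\<lambda>h. 0)"
    using assms(1,2) le eq by (intro differential_zero_maxmin[of x S]) auto
  \<comment> \<open>The zero functional is evaluated at \<open>h = a - b\<close>.\<close>
  then have "(a - b) \<bullet> (a - b) = 0" by metis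
  then show ?thesis by simp
qed

theorem mainTheorem6:
  fixes D :: "('l::finite, 'd::finite, 'm::finite) tracking_model"
    and s :: nat
    and rho_star :: "real^'l \<Rightarrow> nat \<Rightarrow> real"
    and lam grad_L grad_F :: "real^'l"
  assumes "observation_model D"
    and "variational_families D"
    and "finite_expectations D"
    and "s \<in> {1..n_sens D}"
    and "optimal_param D s rho_star"
    and "lam \<in> lam_dom D"
    and "GDERIV (\<lambda>l. local_lm_elbo D s l) lam :> grad_L"
    and "GDERIV (\<lambda>l. local_elbo D s l (rho_star lam)) lam :> grad_F"
  shows "grad_L = grad_F"
proof (rule GDERIV_eq_at_touching_point[OF _ assms(6) _ _ assms(7,8)])
  show "open (lam_dom D)"
    using assms(2) by (simp add: variational_families_def)
  have star: "rho_star lam \<in> rho_dom D s"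
    "\<And>\<theta>. \<theta> \<in> assoc_set D s \<Longrightarrow> q_assoc D s (rho_star lam) \<theta> = opt_assoc D s lam \<theta>"
    using assms(5,6) unfolding optimal_param_def by blast+
  \<comment> \<open>The parameter stays frozen at \<open>rho_star lam\<close> while \<open>l\<close>
    varies, so away from \<open>lam\<close> it is merely an admissible competitor; equality is
    claimed only at \<open>lam\<close>.\<close>
  show "local_elbo D s l (rho_star lam) \<le> local_lm_elbo D s l" if "l \<in> lam_dom D" for l
    by (rule local_elbo_le_local_lm_elbo[OF assms(1-5) that star(1)])
  show "local_lm_elbo D s lam = local_elbo D s lam (rho_star lam)"
    using star(2) by (rule local_lm_elbo_eq_local_elbo)
qed

end
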